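(* Let $G\sim G(n,p)$ be an Erdős–Rényi random graph with $p=p(n)=\Theta(n^{-\beta})$ for a constant $\beta\ge 0$, and let $H$ be obtained from $G$ by a random coarsening with equal cluster sizes ($\pm1$) and coarsening ratio $r=r(n)=\Theta\!\left(\frac{n}{m+n}\right)$. Let $\mathbb{E}[d^{(0)}]$ and $\mathbb{E}[d^{(1)}]$ denote the expected horizontal node degrees in $G$ (the previous layer) and in $H$ (the new layer), respectively. Then, as $n\to\infty$: (1) if $\beta\in\{\tfrac12\}\cup[1,\infty)$, the horizontal node degree remains unchanged up to constant factors: $\mathbb{E}[d^{(1)}]=\Theta(\mathbb{E}[d^{(0)}])$; (2) if $\beta\in[0,\tfrac12)$, the horizontal node degree is asymptotically smaller than the previous one: $\mathbb{E}[d^{(1)}]/\mathbb{E}[d^{(0)}]\to 0$; (3) for all other values of $\beta$, i.e. $\beta\in(\tfrac12,1)$, the horizontal node degree diverges relative to the previous one: $\mathbb{E}[d^{(1)}]/\mathbb{E}[d^{(0)}]\to\infty$.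
   Context: $G(n,p)$ is the random graph on $n$ nodes in which each of the $\binom n2$ possible edges is present independently with probability $p\in(0,1]$. In the condition on $r$, $m=\binom n2 p$ denotes the expected number of edges, and $r\in(0,1)$ with $rn\ge1$. Random coarsening with ratio $r$: the node set is partitioned, randomly and independently of the edges of $G$, into $q=\lfloor rn\rfloor$ clusters $K_1,\dots,K_q$ whose sizes differ by at most 1. The coarsened graph $H$ has one node $v_i$ per cluster $K_i$, and an edge $\{v_i,v_j\}$ ($i\ne j$) if and only if $G$ has at least one edge between $K_i$ and $K_j$. Edges within a single layer ($G$ or $H$) are called horizontal edges, as opposed to the vertical edges that join each node of $G$ to the node of $H$ representing its cluster. The horizontal node degree $d^{(0)}$ (resp. $d^{(1)}$) is the degree of a node within $G$ (resp. the average degree of the nodes within $H$), counting horizontal edges only; expectations are over the random graph and the random partition. *)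

theory Defs
  imports "HOL-Probability.Probability" "HOL-Library.Landau_Symbols"
begin

text \<open>Finite simple graphs are given by a vertex set and a set of two-element edges.\<close>

definition vertex_pairs :: "'a set \<Rightarrow> 'a set set" where
  "vertex_pairs V = {e. e \<subseteq> V \<and> card e = 2}"

definition degree :: "'a set set \<Rightarrow> 'a \<Rightarrow> nat" where
  "degree E v = card {e \<in> E. v \<in> e}"

definition average_degree :: "'a set \<Rightarrow> 'a set set \<Rightarrow> real" where
  "average_degree V E = (\<Sum>v\<in>V. real (degree E v)) / real (card V)"

definition random_graph :: "nat \<Rightarrow> real \<Rightarrow> nat set set pmf" where
  "random_graph n p =
     map_pmf (\<lambda>X. {e \<in> vertex_pairs {..<n}. X e})
       (Pi_pmf (vertex_pairs {..<n}) False (\<lambda>_. bernoulli_pmf p))"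

definition balanced_partition :: "'a set \<Rightarrow> nat \<Rightarrow> 'a set set \<Rightarrow> bool" where
  "balanced_partition V q P \<longleftrightarrow>
     partition_on V P \<and> card P = q \<and> (\<forall>A\<in>P. \<forall>B\<in>P. card A \<le> card B + 1)"

text \<open>The nodes of the coarsened graph are the clusters themselves, i.e. its vertex set
  is the partition.\<close>

definition coarsened_edges :: "'a set set \<Rightarrow> 'a set set \<Rightarrow> 'a set set set" where
  "coarsened_edges P E =
     {{A, B} | A B. A \<in> P \<and> B \<in> P \<and> A \<noteq> B \<and> (\<exists>a\<in>A. \<exists>b\<in>B. {a, b} \<in> E)}"

definition expected_degree :: "nat \<Rightarrow> real \<Rightarrow> nat \<Rightarrow> real" where
  "expected_degree n p v =
     measure_pmf.expectation (random_graph n p) (\<lambda>E. real (degree E v))"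

text \<open>The random partition has law \<open>Q\<close>; the product \<^const>\<open>pair_pmf\<close> makes it
  independent of the edges.\<close>

definition expected_coarsened_degree :: "nat \<Rightarrow> real \<Rightarrow> nat set set pmf \<Rightarrow> real" where
  "expected_coarsened_degree n p Q =
     measure_pmf.expectation (pair_pmf (random_graph n p) Q)
       (\<lambda>(E, P). average_degree P (coarsened_edges P E))"

end

theory Submission
  imports Defs "HOL-Real_Asymp.Real_Asymp"
begin

text \<open>
  Two clusters of sizes \<open>a\<close> and \<open>b\<close> are joined in the coarsened graph with probability
  \<open>1 - (1 - p)\<^sup>a\<^sup>b\<close>, which lies between \<open>x / (1 + x)\<close> and \<open>1\<close> as well as below \<open>p a b\<close>, where
  \<open>x = p n\<^sup>2 / (4 q\<^sup>2) \<le> p a b\<close> because every cluster has at least \<open>n / (2 q)\<close> nodes.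
  Hence \<open>\<bbbE>[d\<^sup>1]\<close> is at most \<open>min q (n\<^sup>2 p / q)\<close> and at least \<open>(q - 1) x / (1 + x)\<close>; for \<open>q \<ge> 2\<close> the
  lower bound says \<open>\<bbbE>[d\<^sup>0] / \<bbbE>[d\<^sup>1] \<le> 2 n p / q + 8 q / n\<close>.
  Since \<open>q\<close> has order \<open>n\<close> to the power \<open>min \<beta> 1\<close> and \<open>\<bbbE>[d\<^sup>0] = (n - 1) p\<close> has order \<open>n\<close> to the power
  \<open>1 - \<beta>\<close>, the three cases follow by comparing exponents.
\<close>

section \<open>Expected degrees\<close>

lemma finite_vertex_pairs: "finite V \<Longrightarrow> finite (vertex_pairs V)"
  by (rule finite_subset[of _ "Pow V"]) (auto simp: vertex_pairs_def)

lemma finite_set_random_graph: "finite (set_pmf (random_graph n p))"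
proof (rule finite_subset)
  show "set_pmf (random_graph n p) \<subseteq> Pow (vertex_pairs {..<n})"
    by (auto simp: random_graph_def)
qed (simp add: finite_vertex_pairs)

text \<open>Avoiding \<open>S\<close> constrains each coordinate of the product measure separately:
  pairs in \<open>S\<close> must be \<open>False\<close>, all others are free. The measure therefore
  factors, with one factor \<open>1 - p\<close> per pair in \<open>S\<close>.\<close>

lemma prob_random_graph_disjoint:
  assumes "S \<subseteq> vertex_pairs {..<n}" and "0 \<le> p" "p \<le> 1"
  shows "measure_pmf.prob (random_graph n p) {E. E \<inter> S = {}} = (1 - p) ^ card S"
proof -
  let ?VP = "vertex_pairs {..<n}"
  have fin: "finite ?VP" by (simp add: finite_vertex_pairs)
  have "measure_pmf.prob (random_graph n p) {E. E \<inter> S = {}} =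
      measure_pmf.prob (Pi_pmf ?VP False (\<lambda>_. bernoulli_pmf p))
        (Pi ?VP (\<lambda>e. if e \<in> S then {False} else UNIV))"
    unfolding random_graph_def measure_map_pmf
    by (rule arg_cong[where f = "measure_pmf.prob _"]) (use assms in \<open>auto simp: Pi_def split: if_splits\<close>)
  also have "\<dots> = (\<Prod>e\<in>?VP. measure_pmf.prob (bernoulli_pmf p) (if e \<in> S then {False} else UNIV))"
    by (rule measure_Pi_pmf_Pi[OF fin])
  also have "\<dots> = (\<Prod>e\<in>?VP. if e \<in> S then 1 - p else 1)"
    using assms by (intro prod.cong) (auto simp: measure_pmf_single)
  also have "\<dots> = (1 - p) ^ card S"
    using assms fin by (simp add: prod.If_cases Int_absorb1)
  finally show ?thesis .
qed

lemma prob_random_graph_intersects: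
  assumes "S \<subseteq> vertex_pairs {..<n}" and "0 \<le> p" "p \<le> 1"
  shows "measure_pmf.prob (random_graph n p) {E. E \<inter> S \<noteq> {}} = 1 - (1 - p) ^ card S"
proof -
  have "{E. E \<inter> S \<noteq> {}} = UNIV - {E. E \<inter> S = {}}" by auto
  then show ?thesis
    using measure_pmf.prob_compl[of "{E. E \<inter> S = {}}" "random_graph n p"]
      prob_random_graph_disjoint[OF assms] by simp
qed

text \<open>Linearity of expectation for a sum of indicators. It serves the degrees in both layers,
  which count single edges in one case and joined clusters in the other.\<close>

lemma expectation_card_random_graph:
  assumes "finite I"
  shows "measure_pmf.expectation (random_graph n p) (\<lambda>E. real (card {i \<in> I. R i E})) =
    (\<Sum>i\<in>I. measure_pmf.prob (random_graph n p) {E. R i E})"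
proof -
  have "real (card {i \<in> I. R i E}) = (\<Sum>i\<in>I. indicator {E. R i E} E)" for E
  proof -
    have "(\<Sum>i\<in>I. indicator {E. R i E} E :: real) = (\<Sum>i\<in>I. if R i E then 1 else 0)"
      by (intro sum.cong) auto
    then show ?thesis using assms by (simp add: sum.If_cases Int_def)
  qed
  then show ?thesis
    by (simp add: Bochner_Integration.integral_sum integrable_measure_pmf_finite
        finite_set_random_graph)
qed

lemma expected_degree_eq:
  assumes "v < n" and "0 \<le> p" "p \<le> 1"
  shows "expected_degree n p v = real (n - 1) * p"
proof -
  let ?I = "{..<n} - {v}"
  \<comment> \<open>Edges at \<open>v\<close> correspond to their other endpoints \<open>w\<close>.
    Presence of an edge is phrased as meeting \<open>{{v, w}}\<close> so that
    \<open>prob_random_graph_intersects\<close> applies. Membership in the support guarantees that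
    \<open>E\<close> consists of two-element sets.\<close>
  have deg: "degree E v = card {w \<in> ?I. E \<inter> {{v, w}} \<noteq> {}}"
    if "E \<in> set_pmf (random_graph n p)" for E
  proof -
    have E: "E \<subseteq> vertex_pairs {..<n}"
      using that by (auto simp: random_graph_def)
    have "{e \<in> E. v \<in> e} = (\<lambda>w. {v, w}) ` {w \<in> ?I. E \<inter> {{v, w}} \<noteq> {}}"
    proof (intro equalityI subsetI)
      fix e assume e: "e \<in> {e \<in> E. v \<in> e}"
      then have "e \<subseteq> {..<n}" "card e = 2" using E by (auto simp: vertex_pairs_def)
      then obtain w where w: "e = {v, w}" "w \<noteq> v"
        using e by (auto simp: card_2_iff doubleton_eq_iff)
      have "w \<in> {w \<in> ?I. E \<inter> {{v, w}} \<noteq> {}}"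
        using e w \<open>e \<subseteq> {..<n}\<close> by simp
      then show "e \<in> (\<lambda>w. {v, w}) ` {w \<in> ?I. E \<inter> {{v, w}} \<noteq> {}}"
        using w(1) by (rule rev_image_eqI)
    qed auto
    then have "degree E v = card ((\<lambda>w. {v, w}) ` {w \<in> ?I. E \<inter> {{v, w}} \<noteq> {}})"
      unfolding degree_def by (rule arg_cong)
    also have "\<dots> = card {w \<in> ?I. E \<inter> {{v, w}} \<noteq> {}}"
      by (rule card_image) (simp add: inj_on_def doubleton_eq_iff)
    finally show ?thesis .
  qed
  have "expected_degree n p v =
      measure_pmf.expectation (random_graph n p) (\<lambda>E. real (card {w \<in> ?I. E \<inter> {{v, w}} \<noteq> {}}))"
    unfolding expected_degree_def
    by (intro integral_cong_AE) (auto simp: deg intro!: AE_pmfI)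
  also have "\<dots> = (\<Sum>w\<in>?I. measure_pmf.prob (random_graph n p) {E. E \<inter> {{v, w}} \<noteq> {}})"
    by (rule expectation_card_random_graph) simp
  also have "\<dots> = (\<Sum>w\<in>?I. p)"
    using assms
    by (intro sum.cong refl, subst prob_random_graph_intersects) (auto simp: vertex_pairs_def)
  finally show ?thesis using assms by simp
qed

text \<open>The map sending \<open>B\<close> to \<open>{A, B}\<close> is a bijection from the
  neighbours of \<open>A\<close> to the edges at \<open>A\<close>. Adjacency becomes the event that
  \<open>E\<close> meets the set of all candidate edges between the two clusters.\<close>

lemma degree_coarsened_edges:
  assumes "A \<in> P"
  shows "degree (coarsened_edges P E) A =
    card {B \<in> P - {A}. E \<inter> (\<lambda>(a, b). {a, b}) ` (A \<times> B) \<noteq> {}}"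
proof -
  define N where "N = {B \<in> P - {A}. E \<inter> (\<lambda>(a, b). {a, b}) ` (A \<times> B) \<noteq> {}}"
  have N: "B \<in> N \<longleftrightarrow> B \<in> P \<and> B \<noteq> A \<and> (\<exists>a\<in>A. \<exists>b\<in>B. {a, b} \<in> E)" for B
    unfolding N_def by fast
  have "{e \<in> coarsened_edges P E. A \<in> e} = (\<lambda>B. {A, B}) ` N"
  proof (intro equalityI subsetI)
    fix e assume "e \<in> {e \<in> coarsened_edges P E. A \<in> e}"
    then obtain C D a b where e: "e = {C, D}" "C \<in> P" "D \<in> P" "C \<noteq> D" "a \<in> C" "b \<in> D"
      "{a, b} \<in> E" "A = C \<or> A = D"
      unfolding coarsened_edges_def by blast
    from e(8) show "e \<in> (\<lambda>B. {A, B}) ` N"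
    proof
      assume "A = C"
      with e have "D \<in> N" unfolding N by blast
      then show ?thesis using e(1) \<open>A = C\<close> by blast
    next
      assume "A = D"
      moreover have "{b, a} \<in> E" using e(7) by (simp add: insert_commute)
      ultimately have "C \<in> N" using e unfolding N by blast
      then show ?thesis using e(1) \<open>A = D\<close> by (simp add: insert_commute rev_image_eqI)
    qed
  next
    fix e assume "e \<in> (\<lambda>B. {A, B}) ` N"
    then obtain B where "e = {A, B}" "B \<in> N" by blast
    with assms show "e \<in> {e \<in> coarsened_edges P E. A \<in> e}"
      unfolding coarsened_edges_def N by blast
  qed
  then have "degree (coarsened_edges P E) A = card ((\<lambda>B. {A, B}) ` N)"
    unfolding degree_def by (rule arg_cong)
  also have "\<dots> = card N"
    by (rule card_image) (simp add: inj_on_def doubleton_eq_iff)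
  finally show ?thesis unfolding N_def .
qed

text \<open>Distinct clusters are disjoint, so pairs in \<open>A \<times> B\<close> give distinct
  candidate edges. There are \<open>card A * card B\<close> of them, and \<open>A\<close> and
  \<open>B\<close> fail to be joined exactly when all are absent.\<close>

lemma expectation_coarsened_degree:
  assumes part: "partition_on {..<n} P" and "A \<in> P" and p: "0 \<le> p" "p \<le> 1"
  shows "measure_pmf.expectation (random_graph n p) (\<lambda>E. real (degree (coarsened_edges P E) A)) =
    (\<Sum>B\<in>P - {A}. 1 - (1 - p) ^ (card A * card B))"
proof -
  have fin: "finite P" using part finite_elements by blast
  have "measure_pmf.prob (random_graph n p) {E. E \<inter> (\<lambda>(a, b). {a, b}) ` (A \<times> B) \<noteq> {}} =
      1 - (1 - p) ^ (card A * card B)" if B: "B \<in> P - {A}" for B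
  proof -
    have AB: "A \<inter> B = {}" "A \<subseteq> {..<n}" "B \<subseteq> {..<n}"
      using part B \<open>A \<in> P\<close> by (auto simp: partition_on_def disjoint_def)
    have "inj_on (\<lambda>(a, b). {a, b}) (A \<times> B)"
    proof (rule inj_onI, clarify)
      fix a b a' b' assume "a \<in> A" "b \<in> B" "a' \<in> A" "b' \<in> B" "{a, b} = {a', b'}"
      with AB(1) show "a = a' \<and> b = b'" by (metis disjoint_iff doubleton_eq_iff)
    qed
    then have "card ((\<lambda>(a, b). {a, b}) ` (A \<times> B)) = card A * card B"
      by (simp add: card_image card_cartesian_product)
    moreover have "(\<lambda>(a, b). {a, b}) ` (A \<times> B) \<subseteq> vertex_pairs {..<n}"
    proof clarify
      fix a b assume "a \<in> A" "b \<in> B"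
      then have "a \<noteq> b" "{a, b} \<subseteq> {..<n}" using AB by auto
      then show "{a, b} \<in> vertex_pairs {..<n}" by (simp add: vertex_pairs_def)
    qed
    ultimately show ?thesis
      using prob_random_graph_intersects[of "(\<lambda>(a, b). {a, b}) ` (A \<times> B)"] p by simp
  qed
  then show ?thesis
    unfolding degree_coarsened_edges[OF \<open>A \<in> P\<close>] expectation_card_random_graph[OF finite_Diff[OF fin]]
    by (rule sum.cong[OF refl])
qed

lemma expectation_average_coarsened_degree:
  assumes part: "partition_on {..<n} P" and p: "0 \<le> p" "p \<le> 1"
  shows "measure_pmf.expectation (random_graph n p) (\<lambda>E. average_degree P (coarsened_edges P E)) =
    (\<Sum>A\<in>P. \<Sum>B\<in>P - {A}. 1 - (1 - p) ^ (card A * card B)) / real (card P)"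
  unfolding average_degree_def
  by (simp add: Bochner_Integration.integral_sum integrable_measure_pmf_finite
      finite_set_random_graph expectation_coarsened_degree[OF part _ p])

text \<open>Fubini as an exchange of finite sums. The inner expectation is over the graph, with the
  partition held fixed.\<close>

lemma expectation_pair_pmf_finite:
  fixes f :: "'a \<times> 'b \<Rightarrow> real"
  assumes "finite (set_pmf M)" "finite (set_pmf N)"
  shows "measure_pmf.expectation (pair_pmf M N) f =
    measure_pmf.expectation N (\<lambda>b. measure_pmf.expectation M (\<lambda>a. f (a, b)))"
proof -
  have "measure_pmf.expectation (pair_pmf M N) f =
      (\<Sum>x\<in>set_pmf M \<times> set_pmf N. f x * pmf (pair_pmf M N) x)"
    using assms by (intro integral_measure_pmf_real) auto
  also have "\<dots> = (\<Sum>a\<in>set_pmf M. \<Sum>b\<in>set_pmf N. f (a, b) * (pmf M a * pmf N b))"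
    by (simp add: sum.cartesian_product case_prod_unfold flip: pmf_pair)
  also have "\<dots> = (\<Sum>b\<in>set_pmf N. (\<Sum>a\<in>set_pmf M. f (a, b) * pmf M a) * pmf N b)"
    by (subst sum.swap) (simp add: sum_distrib_right mult.assoc)
  also have "\<dots> = (\<Sum>b\<in>set_pmf N. measure_pmf.expectation M (\<lambda>a. f (a, b)) * pmf N b)"
    using assms by (intro sum.cong refl arg_cong2[where f = "(*)"], subst integral_measure_pmf_real) auto
  also have "\<dots> = measure_pmf.expectation N (\<lambda>b. measure_pmf.expectation M (\<lambda>a. f (a, b)))"
    using assms by (subst integral_measure_pmf_real) auto
  finally show ?thesis .
qed

text \<open>By independence the graph can be averaged out for each fixed partition; bounds that hold
  uniformly over the support of \<open>Q\<close> then survive averaging over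
  \<open>Q\<close>.\<close>

lemma expected_coarsened_degree_bounds:
  assumes part: "\<And>P. P \<in> set_pmf Q \<Longrightarrow> partition_on {..<n} P"
    and p: "0 \<le> p" "p \<le> 1"
    and bounds: "\<And>P. P \<in> set_pmf Q \<Longrightarrow>
      (\<Sum>A\<in>P. \<Sum>B\<in>P - {A}. 1 - (1 - p) ^ (card A * card B)) / real (card P) \<in> {l..u}"
  shows "expected_coarsened_degree n p Q \<in> {l..u}"
proof -
  define g where "g = (\<lambda>P. measure_pmf.expectation (random_graph n p)
      (\<lambda>E. average_degree P (coarsened_edges P E)))"
  have "set_pmf Q \<subseteq> {P. partition_on {..<n} P}" using part by auto
  then have finQ: "finite (set_pmf Q)"
    using finitely_many_partition_on[of "{..<n}"] finite_subset by blast
  have eq: "expected_coarsened_degree n p Q = measure_pmf.expectation Q g"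
    unfolding expected_coarsened_degree_def g_def
    using finQ by (subst expectation_pair_pmf_finite) (simp_all add: finite_set_random_graph)
  have g: "g P \<in> {l..u}" if "P \<in> set_pmf Q" for P
    using bounds[OF that] expectation_average_coarsened_degree[OF part[OF that] p]
    by (simp add: g_def)
  have int: "integrable (measure_pmf Q) g" by (rule integrable_measure_pmf_finite[OF finQ])
  show ?thesis unfolding eq
    using g int by (auto intro!: measure_pmf.integral_le_const measure_pmf.integral_ge_const AE_pmfI)
qed

section \<open>Bounds in terms of the number of clusters\<close>

text \<open>Every cluster has at most \<open>card A + 1\<close> nodes, which is at most
  \<open>2 * card A\<close> because clusters are nonempty. Summing over the \<open>q\<close>
  clusters gives the bound.\<close>

lemma balanced_partition_card_ge:
  assumes "balanced_partition V q P" "finite V" "A \<in> P"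
  shows "card V \<le> 2 * (q * card A)"
proof -
  have part: "partition_on V P" and q: "card P = q"
    and bal: "\<And>B. B \<in> P \<Longrightarrow> card B \<le> card A + 1"
    using assms by (auto simp: balanced_partition_def)
  have fin: "finite B" if "B \<in> P" for B
    using part that \<open>finite V\<close> by (auto simp: partition_on_def intro: finite_subset)
  have "A \<noteq> {}" using part \<open>A \<in> P\<close> by (auto simp: partition_on_def)
  then have "card A \<ge> 1" using fin[OF \<open>A \<in> P\<close>] by (simp add: Suc_le_eq card_gt_0_iff)
  have "card V = (\<Sum>B\<in>P. card B)" using product_partition[OF part fin] .
  also have "\<dots> \<le> q * (card A + 1)"
    using sum_bounded_above[of P card "card A + 1"] bal q by simp
  also have "\<dots> \<le> q * (2 * card A)" using \<open>card A \<ge> 1\<close> by (intro mult_left_mono) auto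
  finally show ?thesis by simp
qed

lemma one_minus_power_le_mult:
  fixes p :: real
  assumes "p \<le> 1"
  shows "1 - (1 - p) ^ k \<le> p * real k"
  using Bernoulli_inequality[of "- p" k] assms by (simp add: algebra_simps)

text \<open>This follows from \<open>(1 - p) ^ k \<le> exp (- (p * k)) \<le> exp (- x) \<le> 1 / (1
  + x)\<close>. The rational bound agrees with \<open>min x 1\<close> up to a factor 2, so it is
  effective for both small and large \<open>x\<close>.\<close>

lemma one_minus_power_ge:
  fixes p x :: real
  assumes "0 \<le> p" "p \<le> 1" "0 \<le> x" "x \<le> p * real k"
  shows "x / (1 + x) \<le> 1 - (1 - p) ^ k"
proof -
  have "(1 - p) ^ k \<le> exp (- p) ^ k"
    using assms exp_ge_add_one_self[of "- p"] by (intro power_mono) auto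
  also have "\<dots> = exp (- (p * real k))" by (simp add: exp_of_nat_mult[symmetric] mult.commute)
  also have "\<dots> \<le> exp (- x)" using assms by simp
  also have "\<dots> \<le> 1 / (1 + x)"
    using exp_ge_add_one_self[of x] assms by (simp add: exp_minus field_simps)
  finally have "(1 - p) ^ k \<le> 1 / (1 + x)" .
  moreover have "x / (1 + x) = 1 - 1 / (1 + x)" using assms by (simp add: field_simps)
  ultimately show ?thesis by linarith
qed

text \<open>Here \<open>S\<close> is the expected average degree in the coarsened graph given the
  partition \<open>P\<close>. The bounds estimate each joining probability by 1, by Bernoulli's
  inequality, and from below through the minimal cluster size.\<close>

lemma balanced_partition_sum_bounds:
  fixes p :: real
  assumes bal: "balanced_partition {..<n} q P" and q: "q \<ge> 1" and p: "0 \<le> p" "p \<le> 1"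
  defines "S \<equiv> (\<Sum>A\<in>P. \<Sum>B\<in>P - {A}. 1 - (1 - p) ^ (card A * card B)) / real (card P)"
    and "x \<equiv> p * real n ^ 2 / (4 * real q ^ 2)"
  shows "S \<le> real q" "S \<le> real n ^ 2 * p / real q" "(real q - 1) * (x / (1 + x)) \<le> S"
proof -
  have part: "partition_on {..<n} P" and cP: "card P = q"
    using bal by (auto simp: balanced_partition_def)
  have finP: "finite P" using part finite_elements by blast
  have finA: "finite A" if "A \<in> P" for A
    using part that by (auto simp: partition_on_def intro: finite_subset)
  have n: "(\<Sum>A\<in>P. real (card A)) = real n"
    using product_partition[OF part finA] by (simp flip: of_nat_sum)
  have cd: "card (P - {A}) = q - 1" if "A \<in> P" for A
    using that cP finP by simp
  have nonneg: "0 \<le> 1 - (1 - p) ^ k" for k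
    using p by (simp add: power_le_one)
  have x0: "0 \<le> x" using p by (simp add: x_def)
  have "(\<Sum>A\<in>P. \<Sum>B\<in>P - {A}. 1 - (1 - p) ^ (card A * card B)) \<le> (\<Sum>A\<in>P. \<Sum>B\<in>P - {A}. 1)"
    using p by (intro sum_mono) simp
  also have "\<dots> \<le> real q * real q"
    using cd cP q by simp
  finally show "S \<le> real q" using q unfolding S_def cP by (simp add: field_simps)
  \<comment> \<open>Adding the nonnegative diagonal terms lets the double sum factor: after
    Bernoulli's inequality it is \<open>p\<close> times the square of the sum of all cluster
    sizes.\<close>
  have "(\<Sum>A\<in>P. \<Sum>B\<in>P - {A}. 1 - (1 - p) ^ (card A * card B))
      \<le> (\<Sum>A\<in>P. \<Sum>B\<in>P. 1 - (1 - p) ^ (card A * card B))"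
    using finP nonneg by (intro sum_mono sum_mono2) auto
  also have "\<dots> \<le> (\<Sum>A\<in>P. \<Sum>B\<in>P. p * (real (card A) * real (card B)))"
    using one_minus_power_le_mult[OF p(2)] by (intro sum_mono) (metis of_nat_mult)
  also have "\<dots> = real n ^ 2 * p"
    by (simp add: n power2_eq_square flip: sum_distrib_left sum_distrib_right)
  finally show "S \<le> real n ^ 2 * p / real q"
    unfolding S_def cP by (rule divide_right_mono) simp
  have ge: "x / (1 + x) \<le> 1 - (1 - p) ^ (card A * card B)" if "A \<in> P" "B \<in> P" for A B
  proof (rule one_minus_power_ge[OF p x0])
    have "real n \<le> 2 * real q * real (card A)" if "A \<in> P" for A
      using of_nat_mono[OF balanced_partition_card_ge[OF bal _ that], where ?'a = real] by simp
    \<comment> \<open>Multiplying the size bounds for \<open>A\<close> and \<open>B\<close> produces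
      the constant 4 in \<open>x\<close>.\<close>
    then have "real n * real n \<le> (2 * real q * real (card A)) * (2 * real q * real (card B))"
      using that by (intro mult_mono) auto
    then have "real n ^ 2 / (4 * real q ^ 2) \<le> real (card A * card B)"
      using q by (simp add: field_simps power2_eq_square)
    then show "x \<le> p * real (card A * card B)"
      using p(1) mult_left_mono unfolding x_def by fastforce
  qed
  have "real q * ((real q - 1) * (x / (1 + x))) = (\<Sum>A\<in>P. \<Sum>B\<in>P - {A}. x / (1 + x))"
    using cd cP q by (simp add: of_nat_diff)
  also have "\<dots> \<le> (\<Sum>A\<in>P. \<Sum>B\<in>P - {A}. 1 - (1 - p) ^ (card A * card B))"
    using ge by (intro sum_mono) auto
  finally show "(real q - 1) * (x / (1 + x)) \<le> S"
    using q unfolding S_def cP by (simp add: pos_le_divide_eq mult.commute)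
qed

text \<open>The bounds for a fixed partition, averaged over \<open>Q\<close>. The two upper bounds
  enter together as a minimum.\<close>

lemma expected_coarsened_degree_clusters:
  fixes p :: real
  assumes bal: "\<And>P. P \<in> set_pmf Q \<Longrightarrow> balanced_partition {..<n} q P"
    and q: "q \<ge> 1" and p: "0 \<le> p" "p \<le> 1"
  defines "x \<equiv> p * real n ^ 2 / (4 * real q ^ 2)"
  shows "expected_coarsened_degree n p Q \<le> real q"
    "expected_coarsened_degree n p Q \<le> real n ^ 2 * p / real q"
    "(real q - 1) * (x / (1 + x)) \<le> expected_coarsened_degree n p Q"
  using expected_coarsened_degree_bounds[of Q n p "(real q - 1) * (x / (1 + x))"
      "min (real q) (real n ^ 2 * p / real q)"]
    balanced_partition_sum_bounds[OF bal q p] bal p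
  unfolding x_def by (auto simp: balanced_partition_def)

text \<open>The factor is chosen as \<open>n * p\<close> divided by
  \<open>q / 2 * (x / (1 + x))\<close>, and \<open>q \<ge> 2\<close> gives
  \<open>q / 2 \<le> q - 1\<close>. Positivity is recorded for later divisions.\<close>

lemma expected_degree_le_coarsened:
  fixes p :: real
  assumes bal: "\<And>P. P \<in> set_pmf Q \<Longrightarrow> balanced_partition {..<n} q P"
    and q: "q \<ge> 2" and p: "0 < p" "p \<le> 1" and v: "v < n"
  shows "expected_degree n p v \<le>
      (2 * real n * p / real q + 8 * real q / real n) * expected_coarsened_degree n p Q"
    and "0 < expected_coarsened_degree n p Q"
proof -
  define x where "x = p * real n ^ 2 / (4 * real q ^ 2)"
  define W where "W = 2 * real n * p / real q + 8 * real q / real n"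
  have pos: "real n > 0" "real q > 0" using q v by auto
  have x: "x > 0" using p pos by (simp add: x_def)
  have W0: "W \<ge> 0" using p pos by (simp add: W_def)
  have half: "real q / 2 * (x / (1 + x)) \<le> (real q - 1) * (x / (1 + x))"
    using q x by (intro mult_right_mono) auto
  also have ge: "\<dots> \<le> expected_coarsened_degree n p Q"
    unfolding x_def by (rule expected_coarsened_degree_clusters[OF bal]) (use q p in auto)
  finally have le: "real q / 2 * (x / (1 + x)) \<le> expected_coarsened_degree n p Q" .
  show "0 < expected_coarsened_degree n p Q"
    using le x pos by (smt (verit) divide_pos_pos mult_pos_pos)
  have "expected_degree n p v \<le> real n * p"
    using p v by (simp add: expected_degree_eq)
  also have "\<dots> = W * (real q / 2 * (x / (1 + x)))"
  proof -
    have d: "0 < 4 * real q ^ 2 + p * real n ^ 2" using p pos by (simp add: add_pos_pos)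
    have "x / (1 + x) = p * real n ^ 2 / (4 * real q ^ 2 + p * real n ^ 2)"
      using pos d unfolding x_def by (simp add: divide_simps)
    moreover have "W = 2 * (4 * real q ^ 2 + p * real n ^ 2) / (real q * real n)"
      using pos unfolding W_def by (simp add: field_simps power2_eq_square)
    ultimately show ?thesis
      using pos d by (simp add: power2_eq_square)
  qed
  also have "\<dots> \<le> W * expected_coarsened_degree n p Q"
    using le W0 by (rule mult_left_mono)
  finally show "expected_degree n p v \<le>
      (2 * real n * p / real q + 8 * real q / real n) * expected_coarsened_degree n p Q"
    unfolding W_def .
qed

section \<open>Asymptotics\<close>

text \<open>Eventual nonnegativity rules out cancellation, so the sum is at least its dominant term
  \<open>f\<close>.\<close>

lemma bigtheta_add_dominant:
  fixes f g h :: "nat \<Rightarrow> real"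
  assumes "f \<in> \<Theta>(h)" "g \<in> O(h)"
    and "\<forall>\<^sub>F n in sequentially. 0 \<le> f n" "\<forall>\<^sub>F n in sequentially. 0 \<le> g n"
  shows "(\<lambda>n. f n + g n) \<in> \<Theta>(h)"
proof (rule bigthetaI)
  show "(\<lambda>n. f n + g n) \<in> O(h)"
    using assms(1,2) by (intro sum_in_bigo) auto
  have "f \<in> O(\<lambda>n. f n + g n)"
    by (intro bigoI[of _ 1]) (use assms(3,4) in eventually_elim, simp)
  moreover have "h \<in> O(f)"
    using assms(1) by (auto simp: bigtheta_def bigomega_iff_bigo)
  ultimately show "(\<lambda>n. f n + g n) \<in> \<Omega>(h)"
    unfolding bigomega_iff_bigo by (rule landau_o.big_trans[rotated])
qed

lemma real_powr_bigo: "a \<le> b \<Longrightarrow> (\<lambda>n. real n powr a) \<in> O(\<lambda>n. real n powr b)"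
  by (rule bigoI[of _ 1], use eventually_ge_at_top[of 1] in eventually_elim)
    (simp add: powr_mono)

lemma real_powr_tendsto_0: "a < 0 \<Longrightarrow> (\<lambda>n. real n powr a) \<longlonglongrightarrow> 0"
  by real_asymp

lemma real_powr_at_top: "a > 0 \<Longrightarrow> filterlim (\<lambda>n. real n powr a) at_top sequentially"
  by real_asymp

section \<open>Growth order of the number of clusters\<close>

lemma expected_edges_bigtheta:
  fixes \<beta> :: real
  assumes "p \<in> \<Theta>(\<lambda>n. real n powr (- \<beta>))"
  shows "(\<lambda>n. real (n choose 2) * p n) \<in> \<Theta>(\<lambda>n. real n powr (2 - \<beta>))"
proof -
  have choose: "(\<lambda>n. real (n choose 2)) = (\<lambda>n. real n * (real n - 1) / 2)"
  proof
    show "real (n choose 2) = real n * (real n - 1) / 2" for n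
      by (cases n) (simp_all add: choose_two real_of_nat_div algebra_simps)
  qed
  have "(\<lambda>n. real (n choose 2)) \<in> \<Theta>(\<lambda>n. real n powr 2)"
    unfolding choose by real_asymp
  from landau_theta.mult[OF this assms] show ?thesis by (simp only: powr_add[symmetric] add_uminus_conv_diff)
qed

text \<open>The sum \<open>m + n\<close> has order \<open>n\<close> to the power
  \<open>max (2 - \<beta>) 1 = 2 - min \<beta> 1\<close>, so \<open>r n * n\<close>, of order
  \<open>n^2 / (m + n)\<close>, has exponent \<open>min \<beta> 1\<close>.\<close>

lemma cluster_count_bigtheta:
  fixes \<beta> :: real and p r :: "nat \<Rightarrow> real"
  assumes p: "p \<in> \<Theta>(\<lambda>n. real n powr (- \<beta>))" "\<forall>\<^sub>F n in sequentially. 0 < p n \<and> p n \<le> 1"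
    and r: "r \<in> \<Theta>(\<lambda>n. real n / (real (n choose 2) * p n + real n))"
      "\<forall>\<^sub>F n in sequentially. 0 < r n \<and> r n < 1 \<and> r n * real n \<ge> 1"
  shows "(\<lambda>n. real (nat \<lfloor>r n * real n\<rfloor>)) \<in> \<Theta>(\<lambda>n. real n powr min \<beta> 1)"
proof -
  let ?m = "\<lambda>n. real (n choose 2) * p n"
  have m: "?m \<in> \<Theta>(\<lambda>n. real n powr (2 - \<beta>))" by (rule expected_edges_bigtheta[OF p(1)])
  have m0: "\<forall>\<^sub>F n in sequentially. 0 \<le> ?m n" using p(2) by eventually_elim simp
  have size: "(\<lambda>n. ?m n + real n) \<in> \<Theta>(\<lambda>n. real n powr (2 - min \<beta> 1))"
  proof (cases "\<beta> \<le> 1")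
    case True
    have "real \<in> O(\<lambda>n. real n powr (2 - \<beta>))"
      using True real_powr_bigo[of 1 "2 - \<beta>"] by simp
    with True m m0 show ?thesis by (intro bigtheta_add_dominant) auto
  next
    case False
    have "(\<lambda>n. real n powr (2 - \<beta>)) \<in> O(real)"
      using False real_powr_bigo[of "2 - \<beta>" 1] by simp
    then have "?m \<in> O(\<lambda>n. real n powr 1)"
      using m by (auto intro: landau_o.big_trans)
    then have "(\<lambda>n. real n + ?m n) \<in> \<Theta>(\<lambda>n. real n powr 1)"
      using m0 by (intro bigtheta_add_dominant) auto
    with False show ?thesis by (simp add: add.commute)
  qed
  have "(\<lambda>n. r n * real n) \<in> \<Theta>(\<lambda>n. real n / real n powr (2 - min \<beta> 1) * real n)"
  proof (rule landau_theta.mult[OF landau_theta.trans[OF r(1)] bigtheta_refl])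
    show "(\<lambda>n. real n / (?m n + real n)) \<in> \<Theta>(\<lambda>n. real n / real n powr (2 - min \<beta> 1))"
      by (rule bigtheta_divide[OF bigtheta_refl size])
  qed
  also have "(\<lambda>n. real n / real n powr (2 - min \<beta> 1) * real n) \<in> \<Theta>(\<lambda>n. real n powr min \<beta> 1)"
  proof (rule bigthetaI_cong, use eventually_gt_at_top[of 0] in eventually_elim)
    case (elim n)
    then have "real n / real n powr (2 - min \<beta> 1) * real n = real n powr 2 / real n powr (2 - min \<beta> 1)"
      by (simp add: power2_eq_square)
    also have "\<dots> = real n powr (2 - (2 - min \<beta> 1))" by (simp only: powr_diff)
    finally show ?case by simp
  qed
  finally have rn: "(\<lambda>n. r n * real n) \<in> \<Theta>(\<lambda>n. real n powr min \<beta> 1)" .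
  \<comment> \<open>Rounding down a number that is at least 1 loses at most a factor 2.\<close>
  have "(\<lambda>n. real (nat \<lfloor>r n * real n\<rfloor>)) \<in> \<Theta>(\<lambda>n. r n * real n)"
  proof (rule bigthetaI'[of "1/2" 1])
    show "\<forall>\<^sub>F n in sequentially. 1 / 2 * norm (r n * real n) \<le> norm (real (nat \<lfloor>r n * real n\<rfloor>)) \<and>
        norm (real (nat \<lfloor>r n * real n\<rfloor>)) \<le> 1 * norm (r n * real n)"
      using r(2)
    proof eventually_elim
      case (elim n)
      have "\<lfloor>r n * real n\<rfloor> \<ge> 1" using elim by (simp add: le_floor_iff)
      then have "norm (real (nat \<lfloor>r n * real n\<rfloor>)) = of_int \<lfloor>r n * real n\<rfloor>" by simp
      moreover have "norm (r n * real n) = r n * real n" using elim by simp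
      moreover have "(1 :: real) \<le> of_int \<lfloor>r n * real n\<rfloor>"
        using \<open>\<lfloor>r n * real n\<rfloor> \<ge> 1\<close> by linarith
      ultimately show ?case
        using floor_correct[of "r n * real n"] by linarith
    qed
  qed auto
  from landau_theta.trans[OF this rn] show ?thesis .
qed

section \<open>The three regimes of \<beta>\<close>

theorem theorem5:
  fixes \<beta> :: real and p r :: "nat \<Rightarrow> real"
    and Q :: "nat \<Rightarrow> nat set set pmf" and v :: "nat \<Rightarrow> nat"
  assumes "\<beta> \<ge> 0"
    and "\<forall>\<^sub>F n in sequentially. 0 < p n \<and> p n \<le> 1"
    and "p \<in> \<Theta>(\<lambda>n. real n powr (- \<beta>))"
    and "\<forall>\<^sub>F n in sequentially. 0 < r n \<and> r n < 1 \<and> r n * real n \<ge> 1"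
    and "r \<in> \<Theta>(\<lambda>n. real n / (real (n choose 2) * p n + real n))"
    and "\<forall>\<^sub>F n in sequentially. \<forall>P \<in> set_pmf (Q n).
           balanced_partition {..<n} (nat \<lfloor>r n * real n\<rfloor>) P"
    and "\<forall>\<^sub>F n in sequentially. v n < n"
  shows "(\<beta> \<in> {1/2} \<union> {1..} \<longrightarrow>
            (\<lambda>n. expected_coarsened_degree n (p n) (Q n))
              \<in> \<Theta>(\<lambda>n. expected_degree n (p n) (v n)))
       \<and> (\<beta> \<in> {0..<1/2} \<longrightarrow>
            (\<lambda>n. expected_coarsened_degree n (p n) (Q n) / expected_degree n (p n) (v n))
              \<longlonglongrightarrow> 0)
       \<and> (\<beta> \<in> {1/2<..<1} \<longrightarrow>
            filterlim (\<lambda>n. expected_coarsened_degree n (p n) (Q n) / expected_degree n (p n) (v n))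
              at_top sequentially)"
proof -
  define q where "q = (\<lambda>n. nat \<lfloor>r n * real n\<rfloor>)"
  define D0 where "D0 n = expected_degree n (p n) (v n)" for n
  define D1 where "D1 n = expected_coarsened_degree n (p n) (Q n)" for n
  define W where "W = (\<lambda>n. 2 * real n * p n / real (q n) + 8 * real (q n) / real n)"
  note p = assms(2) and pT = assms(3)
  have q: "(\<lambda>n. real (q n)) \<in> \<Theta>(\<lambda>n. real n powr min \<beta> 1)"
    unfolding q_def using assms by (intro cluster_count_bigtheta) auto
  have q1: "\<forall>\<^sub>F n in sequentially. 1 \<le> q n"
    using assms(4) by eventually_elim (simp add: q_def le_nat_iff le_floor_iff)
  have bal: "\<forall>\<^sub>F n in sequentially. \<forall>P \<in> set_pmf (Q n). balanced_partition {..<n} (q n) P"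
    using assms(6) by (simp add: q_def)

  have D0: "D0 \<in> \<Theta>(\<lambda>n. real n powr (1 - \<beta>))"
  proof -
    have "(\<lambda>n. real (n - 1)) \<in> \<Theta>(\<lambda>n. real n powr 1)" by real_asymp
    then have "(\<lambda>n. real (n - 1) * p n) \<in> \<Theta>(\<lambda>n. real n powr 1 * real n powr (- \<beta>))"
      using pT by (rule landau_theta.mult)
    moreover have "\<forall>\<^sub>F n in sequentially. D0 n = real (n - 1) * p n"
      using p assms(7) by eventually_elim (simp add: D0_def expected_degree_eq)
    ultimately show ?thesis
      by (simp only: landau_theta.in_cong powr_add[symmetric] add_uminus_conv_diff)
  qed
  have D0_pos: "\<forall>\<^sub>F n in sequentially. 0 < D0 n"
    using p assms(7) eventually_ge_at_top[of 2]
    by eventually_elim (simp add: D0_def expected_degree_eq)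

  have D1_nonneg: "0 \<le> D1 n" for n
    by (auto simp: D1_def expected_coarsened_degree_def average_degree_def case_prod_unfold
        intro!: Bochner_Integration.integral_nonneg divide_nonneg_nonneg sum_nonneg)
  \<comment> \<open>The bound by the number of clusters is the sharp one for \<beta> up to
    1/2.\<close>
  have D1_q: "D1 \<in> O(\<lambda>n. real n powr min \<beta> 1)"
  proof (rule landau_o.big_trans)
    show "D1 \<in> O(\<lambda>n. real (q n))"
    proof (rule bigoI[of _ 1], use p q1 bal in eventually_elim)
      case (elim n)
      then show ?case
        using expected_coarsened_degree_clusters(1)[of "Q n" n "q n" "p n"] D1_nonneg[of n]
        by (simp add: D1_def)
    qed
  qed (use q in auto)
  \<comment> \<open>The bound by the number of edges per cluster has exponent
    \<open>1 - \<beta>\<close> once \<open>\<beta> \<ge> 1\<close>.\<close>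
  have D1_edges: "D1 \<in> O(\<lambda>n. real n powr (2 - \<beta> - min \<beta> 1))"
  proof (rule landau_o.big_trans)
    show "D1 \<in> O(\<lambda>n. real n powr 2 * p n / real (q n))"
    proof (rule bigoI[of _ 1], use p q1 bal eventually_gt_at_top[of 0] in eventually_elim)
      case (elim n)
      then show ?case
        using expected_coarsened_degree_clusters(2)[of "Q n" n "q n" "p n"] D1_nonneg[of n]
        by (simp add: D1_def)
    qed
    have "(\<lambda>n. real n powr 2 * p n / real (q n)) \<in>
        \<Theta>(\<lambda>n. real n powr 2 * real n powr (- \<beta>) / real n powr min \<beta> 1)"
      by (intro landau_theta.mult bigtheta_divide bigtheta_refl q pT)
    then show "(\<lambda>n. real n powr 2 * p n / real (q n)) \<in>
        O(\<lambda>n. real n powr (2 - \<beta> - min \<beta> 1))"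
      by (intro bigthetaD1) (simp only: powr_add[symmetric] powr_diff[symmetric] add_uminus_conv_diff)
  qed

  \<comment> \<open>Both powers are kept because which one dominates depends on \<beta>.\<close>
  have W: "W \<in> O(\<lambda>n. real n powr (1 - \<beta> - min \<beta> 1) + real n powr (min \<beta> 1 - 1))"
  proof -
    have "(\<lambda>n. 2 * real n * p n / real (q n)) \<in>
        \<Theta>(\<lambda>n. real n powr 1 * real n powr (- \<beta>) / real n powr min \<beta> 1)"
      by (intro landau_theta.mult bigtheta_divide q pT) simp
    then have 1: "(\<lambda>n. 2 * real n * p n / real (q n)) \<in> \<Theta>(\<lambda>n. real n powr (1 - \<beta> - min \<beta> 1))"
      by (simp only: powr_add[symmetric] powr_diff[symmetric] add_uminus_conv_diff)
    have "(\<lambda>n. 8 * real (q n) / real n) \<in> \<Theta>(\<lambda>n. real n powr min \<beta> 1 / real n powr 1)"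
      using q by (intro bigtheta_divide) simp_all
    then have 2: "(\<lambda>n. 8 * real (q n) / real n) \<in> \<Theta>(\<lambda>n. real n powr (min \<beta> 1 - 1))"
      by (simp only: powr_diff)
    show ?thesis
      unfolding W_def
    proof (rule sum_in_bigo)
      show "(\<lambda>n. 2 * real n * p n / real (q n)) \<in>
          O(\<lambda>n. real n powr (1 - \<beta> - min \<beta> 1) + real n powr (min \<beta> 1 - 1))"
        by (rule landau_o.big_trans[OF bigthetaD1[OF 1]]) (auto intro!: bigoI[of _ 1])
      show "(\<lambda>n. 8 * real (q n) / real n) \<in>
          O(\<lambda>n. real n powr (1 - \<beta> - min \<beta> 1) + real n powr (min \<beta> 1 - 1))"
        by (rule landau_o.big_trans[OF bigthetaD1[OF 2]]) (auto intro!: bigoI[of _ 1])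
    qed
  qed

  \<comment> \<open>A positive \<beta> makes the number of clusters tend to infinity, hence
    eventually at least 2. For \<open>\<beta> = 0\<close> it is only of order 1.\<close>
  have lower: "\<forall>\<^sub>F n in sequentially. 0 < D1 n \<and> D0 n \<le> W n * D1 n" if "\<beta> > 0"
  proof -
    have "filterlim (\<lambda>n. real n powr min \<beta> 1) at_infinity sequentially"
      using that by (intro filterlim_at_top_imp_at_infinity real_powr_at_top) simp
    then have "(\<lambda>n. real (q n)) \<in> \<omega>(\<lambda>_. 1 :: real)"
      unfolding landau_omega.small.in_cong_bigtheta[OF q]
      by (intro smallomegaI_filterlim_at_infinity) simp
    then have "filterlim (\<lambda>n. real (q n)) at_top sequentially"
      by (simp add: smallomega_1_conv_filterlim filterlim_at_infinity_conv_norm_at_top)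
    then have "\<forall>\<^sub>F n in sequentially. 2 \<le> real (q n)"
      unfolding filterlim_at_top by blast
    then show ?thesis
      using p bal assms(7)
    proof eventually_elim
      case (elim n)
      then have "2 \<le> q n" by linarith
      with elim show ?case
        using expected_degree_le_coarsened[of "Q n" n "q n" "p n" "v n"]
        by (simp add: D0_def D1_def W_def)
    qed
  qed

  show ?thesis
    unfolding D0_def[symmetric] D1_def[symmetric]
  proof (intro conjI impI)
    assume \<beta>: "\<beta> \<in> {1/2} \<union> {1..}"
    have "D1 \<in> O(\<lambda>n. real n powr (1 - \<beta>))"
    proof (cases "\<beta> = 1/2")
      case True
      then have "min \<beta> 1 = 1 - \<beta>" by simp
      with D1_q show ?thesis by simp
    next
      case False
      with \<beta> have "min \<beta> 1 = 1" by auto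
      with D1_edges show ?thesis by simp
    qed
    then have upper: "D1 \<in> O(D0)"
      using D0 by (metis landau_o.big.cong_bigtheta)
    \<comment> \<open>The exponents are 0 and -1/2 for \<open>\<beta> = 1/2\<close>, and
      \<open>- \<beta>\<close> and 0 for \<open>\<beta> \<ge> 1\<close>. So \<open>W\<close> is
      bounded, and \<open>D0 \<le> W * D1\<close> yields the lower estimate for
      \<open>D1\<close>.\<close>
    have "(\<lambda>n. real n powr (1 - \<beta> - min \<beta> 1) + real n powr (min \<beta> 1 - 1)) \<in> O(\<lambda>_. 1)"
    proof (rule sum_in_bigo)
      have "1 - \<beta> - min \<beta> 1 \<le> 0" "min \<beta> 1 - 1 \<le> 0" using \<beta> by auto
      moreover have "(\<lambda>n. real n powr 0) \<in> O(\<lambda>_. 1)" by (intro bigoI[of _ 1]) simp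
      ultimately show "(\<lambda>n. real n powr (1 - \<beta> - min \<beta> 1)) \<in> O(\<lambda>_. 1)"
        "(\<lambda>n. real n powr (min \<beta> 1 - 1)) \<in> O(\<lambda>_. 1)"
        using real_powr_bigo landau_o.big_trans by blast+
    qed
    with W have W1: "W \<in> O(\<lambda>_. 1)" by (rule landau_o.big_trans)
    have "D0 \<in> O(\<lambda>n. W n * D1 n)"
      using lower D0_pos \<beta> by (intro bigoI[of _ 1]) (auto elim!: eventually_elim2)
    also have "(\<lambda>n. W n * D1 n) \<in> O(\<lambda>n. 1 * D1 n)"
      using W1 by (intro landau_o.big.mult) auto
    finally have "D0 \<in> O(D1)" by simp
    with upper show "D1 \<in> \<Theta>(D0)"
      by (intro bigthetaI) (auto simp: bigomega_iff_bigo)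
  next
    assume \<beta>: "\<beta> \<in> {0..<1/2}"
    \<comment> \<open>Below 1/2 the cluster count alone, of order \<open>n powr \<beta>\<close>, is
      negligible against the degree in the original graph.\<close>
    have "(\<lambda>n. real n powr \<beta>) \<in> o(\<lambda>n. real n powr (1 - \<beta>))"
      using \<beta> by real_asymp
    then have "D1 \<in> o(\<lambda>n. real n powr (1 - \<beta>))"
      using D1_q \<beta> by (auto intro: landau_o.big_small_trans)
    then have "D1 \<in> o(D0)"
      using D0 by (metis landau_o.small.cong_bigtheta)
    then show "(\<lambda>n. D1 n / D0 n) \<longlonglongrightarrow> 0" by (rule smalloD_tendsto)
  next
    assume \<beta>: "\<beta> \<in> {1/2<..<1}"
    \<comment> \<open>Both exponents, \<open>1 - 2 * \<beta>\<close> and \<open>\<beta> - 1\<close>,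
      are negative exactly on this interval, so \<open>W\<close> tends to 0.\<close>
    have "(\<lambda>n. real n powr (1 - \<beta> - min \<beta> 1) + real n powr (min \<beta> 1 - 1)) \<in> o(\<lambda>_. 1)"
      using \<beta> by (intro sum_in_smallo smalloI_tendsto) (auto intro!: real_powr_tendsto_0)
    with W have "W \<in> o(\<lambda>_. 1)" by (rule landau_o.big_small_trans)
    then have W0: "W \<longlonglongrightarrow> 0" by (auto dest: smalloD_tendsto)
    have "\<beta> > 0" using \<beta> by simp
    \<comment> \<open>Positivity of \<open>D0\<close> and \<open>D1\<close> forces \<open>W\<close>
      to be positive, so the inequality inverts and \<open>1 / W\<close> becomes a diverging
      minorant of the ratio.\<close>
    have ev: "\<forall>\<^sub>F n in sequentially. 0 < W n \<and> inverse (W n) \<le> D1 n / D0 n"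
      using lower[OF \<open>\<beta> > 0\<close>] D0_pos
    proof eventually_elim
      case (elim n)
      then have "0 < W n * D1 n" by linarith
      then have "0 < W n" using elim by (simp add: zero_less_mult_iff)
      then show ?case using elim by (simp add: field_simps)
    qed
    have "filterlim (\<lambda>n. inverse (W n)) at_top sequentially"
      using W0 ev by (intro filterlim_inverse_at_top) (auto elim: eventually_mono)
    then show "filterlim (\<lambda>n. D1 n / D0 n) at_top sequentially"
      by (rule filterlim_at_top_mono) (use ev in \<open>auto elim: eventually_mono\<close>)
  qed
qed

end
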